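(* Let $W\subset V$ and $M\le n$. The set $W$ is a norming set for $\mathcal{B}_M$ if and only if the spectral norm of the matrix $\mathbf{B}_M(\mathbf{I}_n-\mathbf{S}_W)\mathbf{B}_M$ is strictly less than $1$. In this case the norming constant satisfies $$\|(\mathbf{S}_W\mathbf{B}_M)^{-1}\|\le\frac{1}{1-\|\mathbf{B}_M(\mathbf{I}_n-\mathbf{S}_W)\mathbf{B}_M\|}.$$
   Context: Let $G$ be a graph with vertex set $V=\{v_1,\dots,v_n\}$, symmetric non-negative weighted adjacency matrix $\mathbf{A}$, degree matrix $\mathbf{D}=\mathrm{diag}(\sum_k\mathbf{A}_{ik})$ (positive), and normalized Laplacian $\mathbf{L}=\mathbf{I}_n-\mathbf{D}^{-1/2}\mathbf{A}\mathbf{D}^{-1/2}$. Signals are vectors in $\mathcal{L}(G)\cong\mathbb{R}^n$ with euclidean norm. Fix an orthonormal eigendecomposition $\mathbf{L}=\mathbf{U}\,\mathrm{diag}(\lambda_1,\dots,\lambda_n)\mathbf{U}^\intercal$ with columns $u_1,\dots,u_n$, and let $\mathcal{B}_M=\mathrm{span}\{u_1,\dots,u_M\}$. Define the projections $\mathbf{S}_W x(v)=x(v)$ for $v\in W$ and $0$ otherwise, and $\mathbf{B}_M x=\sum_{k=1}^M(u_k^\intercal x)u_k$. $W$ is a norming set for $\mathcal{B}_M$ if $\mathbf{S}_W\mathbf{B}_M$ is injective on $\mathcal{B}_M$; then $(\mathbf{S}_W\mathbf{B}_M)^{-1}$ denotes the inverse of $\mathbf{S}_W\mathbf{B}_M|_{\mathcal{B}_M}$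 on the image $\mathbf{S}_W(\mathcal{B}_M)$, and the norming constant is $\|(\mathbf{S}_W\mathbf{B}_M)^{-1}\|=\sup_{z\in\mathbf{S}_W(\mathcal{B}_M),\|z\|\le1}\|(\mathbf{S}_W\mathbf{B}_M)^{-1}z\|$. Matrix norms are spectral norms. *)

theory Defs
  imports "HOL-Analysis.Analysis"
begin

text \<open>Vertices are the elements of a finite type 'n; signals are vectors real^'n.\<close>

definition degree_mat :: "real^'n^'n \<Rightarrow> real^'n^'n" where
  "degree_mat A = (\<chi> i j. if i = j then (\<Sum>k\<in>UNIV. A $ i $ k) else 0)"

definition deg_inv_sqrt :: "real^'n^'n \<Rightarrow> real^'n^'n" where
  "deg_inv_sqrt A = (\<chi> i j. if i = j then 1 / sqrt (\<Sum>k\<in>UNIV. A $ i $ k) else 0)"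

definition norm_laplacian :: "real^'n^'n \<Rightarrow> real^'n^'n" where
  "norm_laplacian A = mat 1 - deg_inv_sqrt A ** A ** deg_inv_sqrt A"

text \<open>Projection onto the vertex set W (diagonal 0/1 matrix S_W).\<close>
definition S_mat :: "'n set \<Rightarrow> real^'n^'n" where
  "S_mat W = (\<chi> i j. if i = j \<and> i \<in> W then 1 else 0)"

text \<open>Orthogonal projection B_M onto span of u_0, ..., u_(M-1) (paper: u_1..u_M).\<close>
definition B_mat :: "(nat \<Rightarrow> real^'n) \<Rightarrow> nat \<Rightarrow> real^'n^'n" where
  "B_mat u M = (\<chi> i j. \<Sum>k<M. u k $ i * u k $ j)"

definition B_space :: "(nat \<Rightarrow> real^'n) \<Rightarrow> nat \<Rightarrow> (real^'n) set" where
  "B_space u M = span (u ` {..<M})"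

text \<open>Spectral norm = operator norm w.r.t. the euclidean norm.\<close>
definition spec_norm :: "real^'n^'n \<Rightarrow> real" where
  "spec_norm T = onorm (\<lambda>x. T *v x)"

definition norming_set :: "(nat \<Rightarrow> real^'n) \<Rightarrow> nat \<Rightarrow> 'n set \<Rightarrow> bool" where
  "norming_set u M W \<longleftrightarrow>
     inj_on (\<lambda>x. S_mat W *v (B_mat u M *v x)) (B_space u M)"

text \<open>Norm of the inverse of S_W B_M restricted to B_M, on the image S_W(B_M).\<close>
definition norming_const :: "(nat \<Rightarrow> real^'n) \<Rightarrow> nat \<Rightarrow> 'n set \<Rightarrow> real" where
  "norming_const u M W =
     Sup ((\<lambda>z. norm (the_inv_into (B_space u M) (\<lambda>x. S_mat W *v (B_mat u M *v x)) z))
          ` {z \<in> (\<lambda>x. S_mat W *v x) ` B_space u M. norm z \<le> 1})"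

end

theory Submission
  imports Defs
begin

text \<open>Write \<open>T = B (I - S) B\<close>. On the range \<open>V\<close> of the orthogonal projection \<open>B\<close>,
  Pythagoras for the coordinate projection \<open>S\<close> gives \<open>\<parallel>y - S y\<parallel>^2 = \<parallel>y\<parallel>^2 - \<parallel>S y\<parallel>^2\<close>.
  If \<open>S\<close> is injective on the finite-dimensional space \<open>V\<close>, it is bounded below there by some
  \<open>c > 0\<close>, hence \<open>\<parallel>T\<parallel> \<le> sqrt (1 - c^2) < 1\<close>. Conversely a nonzero \<open>z \<in> V\<close> with \<open>S z = 0\<close>
  is fixed by \<open>T\<close>, forcing \<open>\<parallel>T\<parallel> \<ge> 1\<close>. Finally, for \<open>x \<in> V\<close> we have \<open>x = T x + B (S x)\<close>,
  so \<open>\<parallel>x\<parallel> \<le> \<parallel>T\<parallel> \<parallel>x\<parallel> + \<parallel>S x\<parallel>\<close>, which is the bound on the norming constant.\<close>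

abbreviation compl_mat :: "(nat \<Rightarrow> real^'n) \<Rightarrow> nat \<Rightarrow> 'n set \<Rightarrow> real^'n^'n" where
  "compl_mat u M W \<equiv> B_mat u M ** (mat 1 - S_mat W) ** B_mat u M"

lemma norm_matrix_vector_le_spec_norm: "norm (T *v x) \<le> spec_norm T * norm x"
  unfolding spec_norm_def by (rule onorm) simp

lemma spec_norm_le: "(\<And>x. norm (T *v x) \<le> c * norm x) \<Longrightarrow> spec_norm T \<le> c"
  unfolding spec_norm_def by (rule onorm_le)

lemma S_mat_vector: "S_mat W *v y = (\<chi> i. if i \<in> W then y $ i else 0)"
proof -
  have "(\<Sum>j\<in>UNIV. (if i = j \<and> i \<in> W then 1 else 0) * y $ j) = (if i \<in> W then y $ i else 0)"
    for i
    by (simp add: if_distrib[of "\<lambda>a. a * _"] conj_commute sum.If_cases)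
  then show ?thesis by (simp add: vec_eq_iff matrix_vector_mult_def S_mat_def)
qed

lemma norm_S_mat_Pythagorean: "norm (y - S_mat W *v y)^2 + norm (S_mat W *v y)^2 = norm y^2"
proof -
  have "orthogonal (y - S_mat W *v y) (S_mat W *v y)"
    by (auto simp: orthogonal_def S_mat_vector inner_vec_def intro!: sum.neutral)
  then show ?thesis
    using norm_add_Pythagorean[of "y - S_mat W *v y" "S_mat W *v y"] by simp
qed

lemma norm_S_mat_complement_le:
  assumes "0 \<le> c" "c \<le> 1" "c * norm y \<le> norm (S_mat W *v y)"
  shows "norm (y - S_mat W *v y) \<le> sqrt (1 - c^2) * norm y"
proof (rule power2_le_imp_le)
  have "(c * norm y)^2 \<le> norm (S_mat W *v y)^2"
    using assms by (intro power_mono) auto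
  then show "norm (y - S_mat W *v y)^2 \<le> (sqrt (1 - c^2) * norm y)^2"
    using norm_S_mat_Pythagorean[of y W] assms(1,2)
    by (simp add: power_mult_distrib power_le_one algebra_simps)
  show "0 \<le> sqrt (1 - c^2) * norm y"
    using assms(1,2) by (simp add: power_le_one)
qed

lemma B_mat_vector_eq_sum: "B_mat u M *v x = (\<Sum>k<M. (u k \<bullet> x) *\<^sub>R u k)"
  by (simp add: vec_eq_iff matrix_vector_mult_def B_mat_def inner_vec_def sum_component
      sum_distrib_left sum_distrib_right mult_ac sum.swap[of _ "{..<M}"])

lemma B_mat_self_adjoint: "(B_mat u M *v x) \<bullet> y = x \<bullet> (B_mat u M *v y)"
  by (simp add: B_mat_vector_eq_sum inner_sum_left inner_sum_right inner_commute mult_ac)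

lemma B_mat_in_B_space: "B_mat u M *v x \<in> B_space u M"
  unfolding B_mat_vector_eq_sum B_space_def
  by (intro span_sum span_scale span_base) auto

lemma compl_mat_vector:
  "compl_mat u M W *v x = B_mat u M *v (B_mat u M *v x - S_mat W *v (B_mat u M *v x))"
  by (simp add: matrix_vector_mul_assoc[symmetric] matrix_vector_mult_diff_rdistrib)

context
  fixes u :: "nat \<Rightarrow> real^'n" and M :: nat
  assumes orthonormal: "\<And>k l. k < M \<Longrightarrow> l < M \<Longrightarrow> u k \<bullet> u l = (if k = l then 1 else 0)"
begin

lemma B_mat_basis: "j < M \<Longrightarrow> B_mat u M *v u j = u j"
  by (simp add: B_mat_vector_eq_sum orthonormal if_distrib[of "\<lambda>a. a *\<^sub>R _"] cong: if_cong)

lemma B_mat_fixes_B_space: "x \<in> B_space u M \<Longrightarrow> B_mat u M *v x = x"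
  unfolding B_space_def
proof (induction rule: span_induct)
  case base
  show ?case by (simp add: subspace_def matrix_vector_right_distrib matrix_vector_mult_scaleR)
next
  case step
  then show ?case using B_mat_basis by auto
qed

lemma norm_B_mat_le: "norm (B_mat u M *v x) \<le> norm x"
proof -
  let ?b = "B_mat u M *v x"
  have "orthogonal (x - ?b) ?b"
    using B_mat_self_adjoint[of u M x ?b] B_mat_fixes_B_space[OF B_mat_in_B_space]
    by (simp add: orthogonal_def inner_diff_left)
  then have "norm ?b^2 \<le> norm x^2"
    using norm_add_Pythagorean[of "x - ?b" ?b] by simp
  then show ?thesis by (simp add: power2_le_iff_abs_le)
qed

lemma norming_set_iff_kernel:
  "norming_set u M W \<longleftrightarrow> (\<forall>x\<in>B_space u M. S_mat W *v x = 0 \<longrightarrow> x = 0)"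
proof -
  have "subspace (B_space u M)"
    unfolding B_space_def by (rule subspace_span)
  then have "inj_on ((*v) (S_mat W)) (B_space u M)
      \<longleftrightarrow> (\<forall>x\<in>B_space u M. S_mat W *v x = 0 \<longrightarrow> x = 0)"
    by (intro linear_inj_on_iff_eq_0 [where f = "(*v) (S_mat W)"]) simp_all
  moreover have "inj_on (\<lambda>x. S_mat W *v (B_mat u M *v x)) (B_space u M)
      \<longleftrightarrow> inj_on ((*v) (S_mat W)) (B_space u M)"
    by (intro inj_on_cong) (simp add: B_mat_fixes_B_space)
  ultimately show ?thesis unfolding norming_set_def by simp
qed

lemma spec_norm_compl_mat_le:
  assumes "0 \<le> c" "c \<le> 1"
    and lower: "\<And>y. y \<in> B_space u M \<Longrightarrow> c * norm y \<le> norm (S_mat W *v y)"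
  shows "spec_norm (compl_mat u M W) \<le> sqrt (1 - c^2)"
proof (rule spec_norm_le)
  fix x
  let ?y = "B_mat u M *v x"
  have "norm (compl_mat u M W *v x) \<le> norm (?y - S_mat W *v ?y)"
    unfolding compl_mat_vector by (rule norm_B_mat_le)
  also have "\<dots> \<le> sqrt (1 - c^2) * norm ?y"
    using assms(1,2) lower[OF B_mat_in_B_space] by (rule norm_S_mat_complement_le)
  also have "\<dots> \<le> sqrt (1 - c^2) * norm x"
    using assms(1,2) by (intro mult_left_mono norm_B_mat_le) (simp add: power_le_one)
  finally show "norm (compl_mat u M W *v x) \<le> sqrt (1 - c^2) * norm x" .
qed

lemma norming_set_imp_spec_norm_lt_1:
  assumes "norming_set u M W"
  shows "spec_norm (compl_mat u M W) < 1"
proof -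
  obtain e where "e > 0" and e: "\<forall>y\<in>B_space u M. e * norm y \<le> norm (S_mat W *v y)"
    using injective_imp_isometric[of "B_space u M" "(*v) (S_mat W)"] assms
    by (auto simp: norming_set_iff_kernel B_space_def closed_subspace)
  define c where "c = min e 1"
  have "c * norm y \<le> norm (S_mat W *v y)" if "y \<in> B_space u M" for y
    using e that mult_right_mono[of c e "norm y"] by (force simp: c_def)
  then have "spec_norm (compl_mat u M W) \<le> sqrt (1 - c^2)"
    using \<open>e > 0\<close> by (intro spec_norm_compl_mat_le) (auto simp: c_def)
  moreover have "sqrt (1 - c^2) < 1"
    using \<open>e > 0\<close> by (simp add: c_def)
  ultimately show ?thesis by linarith
qed

lemma spec_norm_lt_1_imp_norming_set:
  assumes "spec_norm (compl_mat u M W) < 1"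
  shows "norming_set u M W"
  unfolding norming_set_iff_kernel
proof (intro ballI impI)
  fix z assume "z \<in> B_space u M" "S_mat W *v z = 0"
  then have "compl_mat u M W *v z = z"
    by (simp add: compl_mat_vector B_mat_fixes_B_space)
  then have "norm z \<le> spec_norm (compl_mat u M W) * norm z"
    using norm_matrix_vector_le_spec_norm[of "compl_mat u M W" z] by simp
  with assms show "z = 0"
    by (auto simp: mult_le_cancel_right1)
qed

lemma norming_const_le:
  assumes "norming_set u M W"
  shows "norming_const u M W \<le> 1 / (1 - spec_norm (compl_mat u M W))"
  unfolding norming_const_def
proof (rule cSup_least)
  show "(\<lambda>z. norm (the_inv_into (B_space u M) (\<lambda>x. S_mat W *v (B_mat u M *v x)) z))
      ` {z \<in> (*v) (S_mat W) ` B_space u M. norm z \<le> 1} \<noteq> {}"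
    using span_zero[of "u ` {..<M}"] by (force simp: B_space_def)
next
  let ?s = "spec_norm (compl_mat u M W)"
  fix r assume "r \<in> (\<lambda>z. norm (the_inv_into (B_space u M) (\<lambda>x. S_mat W *v (B_mat u M *v x)) z))
      ` {z \<in> (*v) (S_mat W) ` B_space u M. norm z \<le> 1}"
  then obtain x where x: "x \<in> B_space u M" "norm (S_mat W *v x) \<le> 1"
    and r: "r = norm (the_inv_into (B_space u M) (\<lambda>x. S_mat W *v (B_mat u M *v x)) (S_mat W *v x))"
    by blast
  have "r = norm x"
    using r the_inv_into_f_f[OF assms[unfolded norming_set_def] x(1)]
    by (simp add: B_mat_fixes_B_space x(1))
  have decomp: "compl_mat u M W *v x + B_mat u M *v (S_mat W *v x) = x"
    using x(1) by (simp add: compl_mat_vector B_mat_fixes_B_space matrix_vector_mult_diff_distrib)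
  have "norm x \<le> norm (compl_mat u M W *v x) + norm (B_mat u M *v (S_mat W *v x))"
    using norm_triangle_ineq[of "compl_mat u M W *v x" "B_mat u M *v (S_mat W *v x)"]
    by (simp only: decomp)
  also have "\<dots> \<le> ?s * norm x + norm (S_mat W *v x)"
    by (intro add_mono norm_matrix_vector_le_spec_norm norm_B_mat_le)
  finally have "(1 - ?s) * norm x \<le> 1"
    using x(2) by (simp add: algebra_simps)
  moreover have "?s < 1"
    using assms by (rule norming_set_imp_spec_norm_lt_1)
  ultimately show "r \<le> 1 / (1 - ?s)"
    using \<open>r = norm x\<close> by (simp add: field_simps)
qed

end

theorem theorem6:
  fixes A :: "real^'n^'n" and u :: "nat \<Rightarrow> real^'n" and lam :: "nat \<Rightarrow> real"
    and W :: "'n set" and M :: nat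
  assumes symA: "transpose A = A"
    and nonneg: "\<And>i j. A $ i $ j \<ge> 0"
    and degpos: "\<And>i. (\<Sum>k\<in>UNIV. A $ i $ k) > 0"
    and orthonormal: "\<And>k l. k < CARD('n) \<Longrightarrow> l < CARD('n) \<Longrightarrow>
                         u k \<bullet> u l = (if k = l then 1 else 0)"
    and eigen: "\<And>k. k < CARD('n) \<Longrightarrow> norm_laplacian A *v u k = lam k *\<^sub>R u k"
    and M_le: "M \<le> CARD('n)"
  shows "(norming_set u M W \<longleftrightarrow>
           spec_norm (B_mat u M ** (mat 1 - S_mat W) ** B_mat u M) < 1)
         \<and> (norming_set u M W \<longrightarrow>
           norming_const u M W \<le>
             1 / (1 - spec_norm (B_mat u M ** (mat 1 - S_mat W) ** B_mat u M)))"
proof -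
  have orth: "u k \<bullet> u l = (if k = l then 1 else 0)" if "k < M" "l < M" for k l
    using orthonormal that M_le by simp
  show ?thesis
    using norming_set_imp_spec_norm_lt_1[OF orth] spec_norm_lt_1_imp_norming_set[OF orth]
      norming_const_le[OF orth]
    by blast
qed

end
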